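(* Let a unitary process on a finite-dimensional Hilbert space be parametrized by two sets of real parameters $\boldsymbol{\alpha}=\{\alpha_k\}$ and $\boldsymbol{\beta}=\{\beta_l\}$ (the numbers of parameters in the two sets need not be equal), so that $U(\boldsymbol{\alpha})=U(\boldsymbol{\beta})$, where $\boldsymbol{\alpha}=\boldsymbol{\alpha}(\boldsymbol{\beta})$ is a differentiable function of $\boldsymbol{\beta}$ and $U$ is differentiable in $\boldsymbol{\alpha}$. Let $\rho_0$ be a parameter-independent density matrix and let $\rho_{\boldsymbol{\alpha}}=U(\boldsymbol{\alpha})\rho_0U^\dagger(\boldsymbol{\alpha})=U(\boldsymbol{\beta})\rho_0U^\dagger(\boldsymbol{\beta})=\rho_{\boldsymbol{\beta}}$. Let $S$ be the matrix with entries $S_{\alpha_k,\beta_l}=\frac{\partial\alpha_k}{\partial\beta_l}$. Then the quantum Fisher information matrices of the two parametrizations are related by $$F_{\beta_l\beta_{l'}}=\sum_k\sum_{k'}S_{\alpha_k,\beta_l}\,F_{\alpha_k\alpha_{k'}}\,S_{\alpha_{k'},\beta_{l'}},$$ that is, $F^{\{\beta_l\}}=S^{\mathrm t}F^{\{\alpha_k\}}S$.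
   Context: For a differentiable family of density matrices $\rho_{\boldsymbol{\theta}}$ depending on real parameters $\boldsymbol{\theta}=(\theta_1,\dots,\theta_n)$, the quantum Fisher information matrix (of symmetric logarithmic derivative type) is $F_{\theta_i\theta_j}=\tfrac12\mathrm{Tr}\left(\rho_{\boldsymbol{\theta}}\{L_{\theta_i},L_{\theta_j}\}\right)$, where $\{A,B\}=AB+BA$ and $L_{\theta_i}$ is a Hermitian matrix satisfying $\partial_{\theta_i}\rho_{\boldsymbol{\theta}}=\tfrac12\{L_{\theta_i},\rho_{\boldsymbol{\theta}}\}$. When $\rho_{\boldsymbol{\theta}}$ is not invertible, $L_{\theta_i}$ is not unique but $F_{\theta_i\theta_j}$ does not depend on the choice. $F^{\{\alpha_k\}}$ and $F^{\{\beta_l\}}$ denote the matrices with entries $F_{\alpha_k\alpha_{k'}}$ and $F_{\beta_l\beta_{l'}}$, where $F^{\{\alpha_k\}}$ is evaluated at $\boldsymbol{\alpha}=\boldsymbol{\alpha}(\boldsymbol{\beta})$. The notation $U(\boldsymbol{\alpha})=U(\boldsymbol{\beta})$ means that the same unitary is expressed in the two sets of parameters, i.e. $U$ as a function of $\boldsymbol{\beta}$ is the composition of $U$ as a function of $\boldsymbol{\alpha}$ with $\boldsymbol{\alpha}(\boldsymbol{\beta})$. The superscript $\mathrm t$ denotes transpose. *)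

theory Defs
  imports "HOL-Analysis.Analysis"
begin

definition dagger :: "complex^'n^'n \<Rightarrow> complex^'n^'n" where
  "dagger A = (\<chi> i j. cnj (A $ j $ i))"

definition hermitian :: "complex^'n^'n \<Rightarrow> bool" where
  "hermitian A \<longleftrightarrow> dagger A = A"

definition unitary :: "complex^'n^'n \<Rightarrow> bool" where
  "unitary A \<longleftrightarrow> dagger A ** A = mat 1 \<and> A ** dagger A = mat 1"

text \<open>For a Hermitian matrix the quadratic form is real-valued, so taking its real part
  loses nothing.\<close>

definition pos_semidef :: "complex^'n^'n \<Rightarrow> bool" where
  "pos_semidef A \<longleftrightarrow> hermitian A \<and> (\<forall>v. 0 \<le> Re (\<Sum>i\<in>UNIV. cnj (v $ i) * (A *v v) $ i))"

definition density_matrix :: "complex^'n^'n \<Rightarrow> bool" where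
  "density_matrix A \<longleftrightarrow> pos_semidef A \<and> trace A = 1"

definition anticommutator :: "complex^'n^'n \<Rightarrow> complex^'n^'n \<Rightarrow> complex^'n^'n" where
  "anticommutator A B = A ** B + B ** A"

definition partial_deriv :: "(real^'m \<Rightarrow> 'b::real_normed_vector) \<Rightarrow> 'm \<Rightarrow> real^'m \<Rightarrow> 'b" where
  "partial_deriv f i x = vector_derivative (\<lambda>t. f (x + t *\<^sub>R axis i 1)) (at 0)"

definition unitary_family ::
  "(real^'m \<Rightarrow> complex^'n^'n) \<Rightarrow> complex^'n^'n \<Rightarrow> real^'m \<Rightarrow> complex^'n^'n" where
  "unitary_family U \<rho>0 x = U x ** \<rho>0 ** dagger (U x)"

text \<open>Symmetric logarithmic derivatives; not unique when the density matrix is singular.\<close>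

definition is_SLD ::
  "(real^'m \<Rightarrow> complex^'n^'n) \<Rightarrow> real^'m \<Rightarrow> 'm \<Rightarrow> complex^'n^'n \<Rightarrow> bool" where
  "is_SLD \<rho> x i L \<longleftrightarrow>
     hermitian L \<and> partial_deriv \<rho> i x = (1/2) *\<^sub>R anticommutator L (\<rho> x)"

text \<open>The entries are real numbers whose images in the complex numbers are the traces in question.
  The definite description reflects that the value is independent of the chosen \<open>L\<close>.\<close>

definition is_QFIM :: "(real^'m \<Rightarrow> complex^'n^'n) \<Rightarrow> real^'m \<Rightarrow> real^'m^'m \<Rightarrow> bool" where
  "is_QFIM \<rho> x F \<longleftrightarrow>
     (\<exists>L. (\<forall>i. is_SLD \<rho> x i (L i)) \<and>
          (\<forall>i j. complex_of_real (F $ i $ j)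
                 = 1/2 * trace (\<rho> x ** anticommutator (L i) (L j))))"

definition QFIM :: "(real^'m \<Rightarrow> complex^'n^'n) \<Rightarrow> real^'m \<Rightarrow> real^'m^'m" where
  "QFIM \<rho> x = (THE F. is_QFIM \<rho> x F)"

definition param_jacobian :: "(real^'l \<Rightarrow> real^'k) \<Rightarrow> real^'l \<Rightarrow> real^'l^'k" where
  "param_jacobian \<alpha> \<beta> = (\<chi> k l. partial_deriv (\<lambda>b. \<alpha> b $ k) l \<beta>)"

end

theory Submission
  imports Defs
begin

text \<open>The idea: the real inner product of \<open>complex^'n^'n\<close> is the real part of the
  Hilbert--Schmidt product, and for positive semidefinite \<open>\<rho>\<close> the map
  \<open>X \<mapsto> X \<rho> + \<rho> X\<close> is self-adjoint; its kernel consists of the \<open>X\<close> with \<open>X \<rho> = \<rho> X = 0\<close>.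
  The derivative of a unitary family is a commutator \<open>K \<rho> - \<rho> K\<close>, which is orthogonal to that
  kernel, so logarithmic derivatives exist. The Fisher information entries
  are the inner products of \<open>\<partial>\<^sub>i \<rho>\<close> with \<open>L\<^sub>j\<close>, which by self-adjointness do not depend on the choice
  of \<open>L\<close>. By the chain rule, the combinations of the \<open>L\<^sub>k\<close> with the
  coefficients of \<open>S\<close> are logarithmic derivatives for the new parameters.\<close>

section \<open>Conjugate transpose and matrix multiplication as linear operations\<close>

lemma dagger_dagger [simp]: "dagger (dagger A) = A"
  by (simp add: dagger_def vec_eq_iff)

lemma dagger_mult: "dagger (A ** B) = dagger B ** dagger A"
  by (simp add: dagger_def matrix_matrix_mult_def vec_eq_iff mult.commute)

lemma dagger_add: "dagger (A + B) = dagger A + dagger B"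
  by (simp add: dagger_def vec_eq_iff)

lemma dagger_diff: "dagger (A - B) = dagger A - dagger B"
  by (simp add: dagger_def vec_eq_iff)

lemma dagger_scaleR: "dagger (c *\<^sub>R A) = c *\<^sub>R dagger A"
  by (simp add: dagger_def vec_eq_iff)

lemma bounded_linear_dagger: "bounded_linear (dagger :: complex^'n^'n \<Rightarrow> _)"
  by (intro linear_conv_bounded_linear[THEN iffD1] linearI) (simp_all add: dagger_add dagger_scaleR)

text \<open>Through the interpretation \<open>mm\<close> this supplies distributivity, scaling and
  the product rule \<open>mm.FDERIV\<close> for matrix products.\<close>

lemma bounded_bilinear_matrix_mult:
  "bounded_bilinear ((**) :: complex^'n^'n \<Rightarrow> complex^'n^'n \<Rightarrow> complex^'n^'n)"
  by (intro bilinear_conv_bounded_bilinear[THEN iffD1])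
     (auto simp: bilinear_def matrix_matrix_mult_def vec_eq_iff algebra_simps sum.distrib
       scaleR_sum_right intro!: linearI)

interpretation mm: bounded_bilinear
  "(**) :: complex^'n^'n \<Rightarrow> complex^'n^'n \<Rightarrow> complex^'n^'n"
  by (rule bounded_bilinear_matrix_mult)

lemma hermitian_sum:
  fixes L :: "'k::finite \<Rightarrow> complex^'n^'n"
  assumes "\<And>k. hermitian (L k)"
  shows "hermitian (\<Sum>k\<in>UNIV. c k *\<^sub>R L k)"
  using assms
  by (simp add: hermitian_def bounded_linear.linear[OF bounded_linear_dagger, THEN linear_sum] dagger_scaleR)

section \<open>The real Hilbert-Schmidt inner product\<close>

lemma cnj_trace: "cnj (trace A) = trace (dagger A)"
  by (simp add: trace_def dagger_def)

lemma inner_eq_Re_trace: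
  fixes X Y :: "complex^'n^'n"
  shows "X \<bullet> Y = Re (trace (dagger X ** Y))"
proof -
  have "X \<bullet> Y = (\<Sum>i\<in>UNIV. \<Sum>j\<in>UNIV. Re (cnj (X $ i $ j) * Y $ i $ j))"
    by (simp add: inner_vec_def inner_complex_def)
  also have "\<dots> = Re (trace (dagger X ** Y))"
    by (subst sum.swap) (simp add: trace_def matrix_matrix_mult_def dagger_def)
  finally show ?thesis .
qed

lemma inner_mult_left:
  fixes A X Y :: "complex^'n^'n"
  shows "(A ** X) \<bullet> Y = X \<bullet> (dagger A ** Y)"
  by (simp add: inner_eq_Re_trace dagger_mult matrix_mul_assoc)

lemma inner_dagger:
  fixes X Y :: "complex^'n^'n"
  shows "dagger X \<bullet> dagger Y = X \<bullet> Y"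
proof -
  have "cnj (trace (dagger Y ** X)) = trace (dagger X ** Y)"
    by (simp add: cnj_trace dagger_mult)
  then show ?thesis
    by (metis cnj.sel(1) inner_commute inner_eq_Re_trace dagger_dagger trace_mul_sym)
qed

text \<open>Reduces to left multiplication, because \<open>dagger\<close> preserves the inner
  product and reverses products.\<close>

lemma inner_mult_right:
  fixes A X Y :: "complex^'n^'n"
  shows "(X ** A) \<bullet> Y = X \<bullet> (Y ** dagger A)"
  using inner_mult_left[of "dagger A" "dagger X" "dagger Y"]
  by (metis dagger_dagger dagger_mult inner_dagger)

section \<open>Self-adjoint maps on real inner product spaces\<close>

lemma psd_form_zero_imp_zero:
  fixes f :: "'a::real_inner \<Rightarrow> 'a"
  assumes "linear f" and sa: "\<And>x y. f x \<bullet> y = x \<bullet> f y" and nn: "\<And>x. 0 \<le> x \<bullet> f x"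
    and x: "x \<bullet> f x = 0"
  shows "f x = 0"
proof (rule ccontr)
  assume "f x \<noteq> 0"
  define a b where "a = f x \<bullet> f x" and "b = f x \<bullet> f (f x)"
  \<comment> \<open>The form at \<open>x - t f x\<close> equals \<open>t * (t * b - 2 * a)\<close>,
    which is negative for small positive \<open>t\<close>. This \<open>t\<close> is small enough,
    and the \<open>+ 1\<close> covers \<open>b = 0\<close>.\<close>
  define t where "t = a / (b + 1)"
  have a: "a > 0" using \<open>f x \<noteq> 0\<close> by (simp add: a_def)
  have b: "b \<ge> 0" using nn[of "f x"] by (simp add: b_def)
  have t: "t > 0" using a b by (simp add: t_def)
  have "0 \<le> (x - t *\<^sub>R f x) \<bullet> f (x - t *\<^sub>R f x)" by (rule nn)
  also have "\<dots> = t * (t * b - 2 * a)"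
    using x sa[of x "f x"] unfolding a_def b_def
    by (simp add: linear_diff[OF assms(1)] linear_scale[OF assms(1)] inner_diff_left
        inner_diff_right algebra_simps)
  finally have "2 * a \<le> t * b" using t by (simp add: zero_le_mult_iff)
  also have "t * b \<le> a"
    using a b by (simp add: t_def divide_simps)
  finally show False using a by simp
qed

text \<open>In finite dimension the range of a self-adjoint map is the orthogonal complement of its
  kernel. The component \<open>z\<close> of \<open>d\<close> orthogonal to the range lies in the
  kernel, hence is orthogonal to \<open>d\<close> and so to itself.\<close>

lemma range_selfadjoint:
  fixes f :: "'a::euclidean_space \<Rightarrow> 'a"
  assumes f: "linear f" and sa: "\<And>x y. f x \<bullet> y = x \<bullet> f y"
    and orth: "\<And>x. f x = 0 \<Longrightarrow> x \<bullet> d = 0"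
  shows "d \<in> range f"
proof -
  have sub: "subspace (range f)"
    using f by (intro linear_subspace_image) auto
  obtain y z where yz: "y \<in> span (range f)" "\<And>w. w \<in> span (range f) \<Longrightarrow> orthogonal z w" "d = y + z"
    using orthogonal_subspace_decomp_exists[of "range f" d] by blast
  have z: "z \<bullet> w = 0" if "w \<in> range f" for w
    using yz(2)[of w] that by (simp add: orthogonal_def span_base)
  have "f z \<bullet> f z = 0" using z[of "f (f z)"] sa[of z "f z"] by simp
  then have "z \<bullet> d = 0" using orth by simp
  moreover have "z \<bullet> y = 0" using z yz(1) sub by (metis span_eq_iff)
  ultimately have "z = 0" using yz(3) by (simp add: inner_add_right)
  then show ?thesis using yz sub by (metis add_0_right span_eq_iff)
qed

section \<open>Positive semidefinite matrices and the anticommutator map\<close>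

lemma pos_semidef_inner_nonneg:
  fixes R X :: "complex^'n^'n"
  assumes "pos_semidef R"
  shows "0 \<le> X \<bullet> (R ** X)"
proof -
  \<comment> \<open>The trace splits into the quadratic forms of \<open>R\<close> at the columns of
    \<open>X\<close>.\<close>
  have "trace (dagger X ** (R ** X)) =
      (\<Sum>j\<in>UNIV. \<Sum>i\<in>UNIV. cnj (column j X $ i) * (R *v column j X) $ i)"
    by (simp add: trace_def matrix_matrix_mult_def dagger_def matrix_vector_mult_def column_def)
  then have "X \<bullet> (R ** X) =
      (\<Sum>j\<in>UNIV. Re (\<Sum>i\<in>UNIV. cnj (column j X $ i) * (R *v column j X) $ i))"
    by (simp only: inner_eq_Re_trace Re_sum)
  also have "\<dots> \<ge> 0"
    using assms unfolding pos_semidef_def by (intro sum_nonneg) blast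
  finally show ?thesis .
qed

text \<open>The form of the conjugated matrix at \<open>v\<close> is the form of \<open>R\<close> at
  \<open>dagger W *v v\<close>.\<close>

lemma pos_semidef_conjugate:
  assumes "pos_semidef R"
  shows "pos_semidef (W ** R ** dagger W)"
proof -
  have R: "dagger R = R" using assms by (simp add: pos_semidef_def hermitian_def)
  have adj: "(\<Sum>i\<in>UNIV. cnj (v $ i) * (W *v u) $ i) = (\<Sum>i\<in>UNIV. cnj ((dagger W *v v) $ i) * u $ i)"
    for u v :: "complex^'a"
    unfolding matrix_vector_mult_def dagger_def
    by (simp add: sum_distrib_left sum_distrib_right, subst sum.swap) (simp add: mult_ac)
  have "0 \<le> Re (\<Sum>i\<in>UNIV. cnj (v $ i) * ((W ** R ** dagger W) *v v) $ i)" for v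
  proof -
    have "(W ** R ** dagger W) *v v = W *v (R *v (dagger W *v v))"
      by (simp add: matrix_vector_mul_assoc matrix_mul_assoc)
    then show ?thesis
      using assms by (simp add: adj pos_semidef_def)
  qed
  then show ?thesis
    by (simp add: pos_semidef_def hermitian_def dagger_mult R matrix_mul_assoc)
qed

lemma linear_anticommutator: "linear (\<lambda>X. anticommutator X R)"
  by (rule linearI)
     (simp_all add: anticommutator_def mm.add_left mm.add_right mm.scaleR_left mm.scaleR_right
       scaleR_add_right)

lemma anticommutator_selfadjoint:
  assumes "hermitian R"
  shows "anticommutator X R \<bullet> Y = X \<bullet> anticommutator Y R"
  using assms
  by (simp add: anticommutator_def inner_add_left inner_add_right inner_mult_left[of R]
      inner_mult_right[of _ R] hermitian_def)

lemma dagger_anticommutator: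
  "dagger (anticommutator X Y) = anticommutator (dagger X) (dagger Y)"
  by (simp add: anticommutator_def dagger_add dagger_mult add.commute)

text \<open>Pairing the anticommutator with \<open>X\<close> gives a sum of two nonnegative terms,
  so each vanishes. A positive semidefinite form vanishes only on the kernel of its map, here left
  multiplication by \<open>R\<close>.\<close>

lemma anticommutator_zero_imp:
  assumes psd: "pos_semidef R" and zero: "anticommutator X R = 0"
  shows "R ** X = 0" and "X ** R = 0"
proof -
  have R: "dagger R = R" using psd by (simp add: pos_semidef_def hermitian_def)
  \<comment> \<open>This turns the right-multiplication form at \<open>X\<close> into the
    left-multiplication form at \<open>dagger X\<close>, whose sign is known.\<close>
  have eq: "X \<bullet> (X ** R) = dagger X \<bullet> (R ** dagger X)"
    using inner_dagger[of X "X ** R"] by (simp add: dagger_mult R)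
  have "X \<bullet> (X ** R) + X \<bullet> (R ** X) = X \<bullet> anticommutator X R"
    by (simp add: anticommutator_def inner_add_right)
  then have "X \<bullet> (R ** X) = 0"
    using pos_semidef_inner_nonneg[OF psd, of X] pos_semidef_inner_nonneg[OF psd, of "dagger X"]
      eq zero by simp
  then show "R ** X = 0"
    by (intro psd_form_zero_imp_zero[of "\<lambda>X. R ** X"])
       (auto simp: inner_mult_left R pos_semidef_inner_nonneg[OF psd]
          mm.add_right mm.scaleR_right intro!: linearI)
  then show "X ** R = 0" using zero by (simp add: anticommutator_def)
qed

text \<open>Solves the equation for the logarithmic derivative: the commutator is orthogonal to the
  kernel of the self-adjoint anticommutator map, hence lies in its range.\<close>

lemma commutator_eq_anticommutator:
  assumes psd: "pos_semidef R" and K: "dagger K = - K"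
  obtains L where "hermitian L" "K ** R - R ** K = (1/2) *\<^sub>R anticommutator L R"
proof -
  have hR: "hermitian R" and R: "dagger R = R" using psd by (simp_all add: pos_semidef_def hermitian_def)
  have "X \<bullet> (K ** R - R ** K) = 0" if "anticommutator X R = 0" for X
  proof -
    have "X \<bullet> (K ** R - R ** K) = (X ** R) \<bullet> K - (R ** X) \<bullet> K"
      by (simp add: inner_diff_right inner_mult_left[of R] inner_mult_right[of _ R] R)
    then show ?thesis using anticommutator_zero_imp[OF psd that] by simp
  qed
  then have "K ** R - R ** K \<in> range (\<lambda>X. anticommutator X R)"
    by (intro range_selfadjoint linear_anticommutator anticommutator_selfadjoint[OF hR])
  then obtain M where M: "K ** R - R ** K = anticommutator M R" by auto
  \<comment> \<open>The commutator is Hermitian, so \<open>dagger M\<close> solves the same equation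
    as \<open>M\<close>. Their sum is a Hermitian solution for twice the right-hand side, which the
    factor \<open>1/2\<close> absorbs.\<close>
  have "dagger (K ** R - R ** K) = K ** R - R ** K"
    by (simp add: dagger_diff dagger_mult R K mm.minus_left mm.minus_right)
  then have "anticommutator (dagger M) R = K ** R - R ** K"
    by (simp add: M dagger_anticommutator R)
  then have "anticommutator (M + dagger M) R = 2 *\<^sub>R (K ** R - R ** K)"
    by (simp add: M linear_add[OF linear_anticommutator] scaleR_2)
  moreover have "hermitian (M + dagger M)"
    by (simp add: hermitian_def dagger_add add.commute)
  ultimately show thesis using that[of "M + dagger M"] by simp
qed

section \<open>Fisher information entries as inner products\<close>

lemma SLD_trace_eq_inner:
  assumes R: "hermitian (\<rho> x)" and i: "is_SLD \<rho> x i M" and N: "hermitian N"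
  shows "1/2 * trace (\<rho> x ** anticommutator M N) = complex_of_real (partial_deriv \<rho> i x \<bullet> N)"
proof -
  define D where "D = partial_deriv \<rho> i x"
  have M: "hermitian M" and D: "D = (1/2) *\<^sub>R anticommutator M (\<rho> x)"
    using i by (auto simp: is_SLD_def D_def)
  have hD: "dagger D = D"
    using M R by (simp add: D dagger_scaleR dagger_anticommutator hermitian_def)
  have "trace (\<rho> x ** anticommutator M N) = trace (\<rho> x ** M ** N) + trace (\<rho> x ** N ** M)"
    by (simp add: anticommutator_def mm.add_right trace_add matrix_mul_assoc)
  \<comment> \<open>Cyclicity moves \<open>M\<close> to the front, so that both terms regroup into
    the anticommutator of \<open>M\<close> with the state, times \<open>N\<close>.\<close>
  also have "trace (\<rho> x ** N ** M) = trace (M ** \<rho> x ** N)"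
    using trace_mul_sym[of "\<rho> x ** N" M] by (simp add: matrix_mul_assoc)
  also have "trace (\<rho> x ** M ** N) + \<dots> = trace (anticommutator M (\<rho> x) ** N)"
    by (simp add: anticommutator_def mm.add_left trace_add add.commute)
  also have "anticommutator M (\<rho> x) = D + D"
    by (simp add: D flip: scaleR_2)
  finally have eq: "1/2 * trace (\<rho> x ** anticommutator M N) = trace (D ** N)"
    by (simp only: mm.add_left trace_add) simp
  \<comment> \<open>The trace of a product of two Hermitian matrices is real, so passing to the real
    part loses nothing.\<close>
  have "cnj (trace (D ** N)) = trace (D ** N)"
    using N trace_mul_sym[of N D] by (simp add: cnj_trace dagger_mult hD hermitian_def)
  then have "trace (D ** N) = complex_of_real (Re (trace (D ** N)))"
    by (simp add: complex_eq_iff)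
  then show ?thesis
    by (simp only: eq inner_eq_Re_trace hD flip: D_def)
qed

text \<open>In this asymmetric form only the second index involves the choice of \<open>L\<close>,
  and the entries are linear in it.\<close>

lemma is_QFIM_iff_inner:
  assumes R: "hermitian (\<rho> x)"
  shows "is_QFIM \<rho> x F \<longleftrightarrow>
    (\<exists>L. (\<forall>i. is_SLD \<rho> x i (L i)) \<and> (\<forall>i j. F $ i $ j = partial_deriv \<rho> i x \<bullet> L j))"
proof -
  have "complex_of_real (F $ i $ j) = 1/2 * trace (\<rho> x ** anticommutator (L i) (L j)) \<longleftrightarrow>
      F $ i $ j = partial_deriv \<rho> i x \<bullet> L j"
    if L: "\<forall>i. is_SLD \<rho> x i (L i)" for L i j
  proof -
    have "is_SLD \<rho> x i (L i)" "hermitian (L j)" using L by (simp_all add: is_SLD_def)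
    from SLD_trace_eq_inner[of \<rho> x, OF R this] show ?thesis
      by (simp only: of_real_eq_iff)
  qed
  then show ?thesis
    unfolding is_QFIM_def by (intro arg_cong[where f = Ex] ext conj_cong refl) simp
qed

lemma QFIM_eqI:
  assumes R: "hermitian (\<rho> x)" and L: "\<And>i. is_SLD \<rho> x i (L i)"
    and F: "\<And>i j. F $ i $ j = partial_deriv \<rho> i x \<bullet> L j"
  shows "QFIM \<rho> x = F"
  unfolding QFIM_def
proof (rule the_equality)
  show "is_QFIM \<rho> x F"
    unfolding is_QFIM_iff_inner[of \<rho>, OF R] using L F by blast
next
  fix G assume "is_QFIM \<rho> x G"
  then obtain M where M: "\<And>i. is_SLD \<rho> x i (M i)" "\<And>i j. G $ i $ j = partial_deriv \<rho> i x \<bullet> M j"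
    unfolding is_QFIM_iff_inner[of \<rho>, OF R] by blast
  \<comment> \<open>Self-adjointness moves the anticommutator onto the second factor, where
    \<open>M j\<close> and \<open>L j\<close> give the same derivative of the state.\<close>
  have "partial_deriv \<rho> i x \<bullet> M j = partial_deriv \<rho> i x \<bullet> L j" for i j
  proof -
    have D: "partial_deriv \<rho> i x = (1/2) *\<^sub>R anticommutator (L i) (\<rho> x)"
      using L by (simp add: is_SLD_def)
    have "anticommutator (M j) (\<rho> x) = anticommutator (L j) (\<rho> x)"
      using L[of j] M(1)[of j] by (simp add: is_SLD_def)
    then show ?thesis
      by (simp add: D anticommutator_selfadjoint[OF R])
  qed
  then show "G = F" by (simp add: vec_eq_iff M F)
qed

section \<open>Derivatives of unitary families\<close>

lemma partial_deriv_eq: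
  assumes "(f has_derivative f') (at x)"
  shows "partial_deriv f i x = f' (axis i 1)"
proof -
  have g: "((\<lambda>t. x + t *\<^sub>R axis i 1) has_derivative (\<lambda>t. t *\<^sub>R axis i 1)) (at 0)"
    by (auto intro!: derivative_eq_intros)
  have "((\<lambda>t. f (x + t *\<^sub>R axis i 1)) has_derivative (\<lambda>t. f' (t *\<^sub>R axis i 1))) (at 0)"
    by (rule has_derivative_compose[OF g]) (simp add: assms)
  then have "((\<lambda>t. f (x + t *\<^sub>R axis i 1)) has_vector_derivative f' (axis i 1)) (at 0)"
    unfolding has_vector_derivative_def
    by (simp add: linear_scale[OF has_derivative_linear[OF assms]])
  then show ?thesis
    unfolding partial_deriv_def by (rule vector_derivative_at)
qed

lemma unitary_family_has_derivative:
  assumes "(U has_derivative U') (at x)"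
  shows "(unitary_family U \<rho>0 has_derivative
    (\<lambda>h. U x ** \<rho>0 ** dagger (U' h) + U' h ** \<rho>0 ** dagger (U x))) (at x)"
proof -
  have "((\<lambda>y. U y ** \<rho>0) has_derivative (\<lambda>h. U' h ** \<rho>0)) (at x)"
    using bounded_linear.has_derivative[OF mm.bounded_linear_left assms] .
  moreover have "((\<lambda>y. dagger (U y)) has_derivative (\<lambda>h. dagger (U' h))) (at x)"
    using bounded_linear.has_derivative[OF bounded_linear_dagger assms] .
  ultimately show ?thesis
    unfolding unitary_family_def[abs_def] by (rule mm.FDERIV)
qed

text \<open>Differentiates \<open>U y ** dagger (U y) = mat 1\<close>. With \<open>mat 1\<close> as
  initial matrix the unitary family is exactly this product, constant on \<open>A\<close>.\<close>

lemma unitary_derivative_skew: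
  fixes U :: "real^'m \<Rightarrow> complex^'n^'n"
  assumes "(U has_derivative U') (at x)" "open A" "x \<in> A" "\<And>y. y \<in> A \<Longrightarrow> unitary (U y)"
  shows "dagger (U' h ** dagger (U x)) = - (U' h ** dagger (U x))"
proof -
  have "(unitary_family U (mat 1) has_derivative
      (\<lambda>h. U x ** mat 1 ** dagger (U' h) + U' h ** mat 1 ** dagger (U x))) (at x)"
    by (rule unitary_family_has_derivative[OF assms(1)])
  moreover have "(unitary_family U (mat 1) has_derivative (\<lambda>h. 0)) (at x)"
    by (rule has_derivative_transform_within_open[OF has_derivative_const[of "mat 1"] assms(2,3)])
       (use assms(4) in \<open>simp add: unitary_family_def unitary_def\<close>)
  ultimately have "(\<lambda>h. U x ** mat 1 ** dagger (U' h) + U' h ** mat 1 ** dagger (U x)) = (\<lambda>h. 0)"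
    by (rule has_derivative_unique)
  from fun_cong[OF this, of h] show ?thesis
    by (simp add: dagger_mult eq_neg_iff_add_eq_0)
qed

lemma unitary_family_SLD_exists:
  fixes U :: "real^'m \<Rightarrow> complex^'n^'n"
  assumes U: "(U has_derivative U') (at x)" "open A" "x \<in> A" "\<And>y. y \<in> A \<Longrightarrow> unitary (U y)"
    and psd: "pos_semidef \<rho>0"
  shows "\<exists>L. is_SLD (unitary_family U \<rho>0) x i L"
proof -
  \<comment> \<open>\<open>K\<close> is the generator: the partial derivative of \<open>U\<close> is
    \<open>K ** U x\<close>, so that of the state is the commutator of \<open>K\<close> with
    \<open>R\<close>.\<close>
  define K where "K = U' (axis i 1) ** dagger (U x)"
  define R where "R = unitary_family U \<rho>0 x"
  have uU: "dagger (U x) ** U x = mat 1" using U(3,4) by (simp add: unitary_def)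
  have K: "dagger K = - K" unfolding K_def by (rule unitary_derivative_skew[OF U])
  have "pos_semidef R" unfolding R_def unitary_family_def by (rule pos_semidef_conjugate[OF psd])
  then obtain L where L: "hermitian L" "K ** R - R ** K = (1/2) *\<^sub>R anticommutator L R"
    using commutator_eq_anticommutator K by blast
  have "K ** R = U' (axis i 1) ** (dagger (U x) ** U x) ** \<rho>0 ** dagger (U x)"
    by (simp add: K_def R_def unitary_family_def matrix_mul_assoc)
  then have KR: "K ** R = U' (axis i 1) ** \<rho>0 ** dagger (U x)"
    by (simp add: uU)
  have "R ** dagger K = U x ** \<rho>0 ** (dagger (U x) ** U x) ** dagger (U' (axis i 1))"
    by (simp add: K_def R_def unitary_family_def matrix_mul_assoc dagger_mult)
  then have RK: "U x ** \<rho>0 ** dagger (U' (axis i 1)) = - (R ** K)"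
    by (simp add: uU K mm.minus_right)
  have "partial_deriv (unitary_family U \<rho>0) i x =
      U x ** \<rho>0 ** dagger (U' (axis i 1)) + U' (axis i 1) ** \<rho>0 ** dagger (U x)"
    by (rule partial_deriv_eq[OF unitary_family_has_derivative[OF U(1)]])
  also have "\<dots> = K ** R - R ** K"
    by (simp add: KR RK)
  finally have "partial_deriv (unitary_family U \<rho>0) i x = K ** R - R ** K" .
  then show ?thesis using L by (auto simp: is_SLD_def R_def)
qed

section \<open>Chain rule and transformation of the Fisher information\<close>

lemma partial_deriv_chain:
  fixes f :: "real^'k \<Rightarrow> 'b::real_normed_vector" and \<alpha> :: "real^'l \<Rightarrow> real^'k"
  assumes f: "f differentiable (at (\<alpha> \<beta>))" and \<alpha>: "\<alpha> differentiable (at \<beta>)"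
    and B: "open B" "\<beta> \<in> B" "\<And>b. b \<in> B \<Longrightarrow> g b = f (\<alpha> b)"
  shows "partial_deriv g l \<beta> =
    (\<Sum>k\<in>UNIV. param_jacobian \<alpha> \<beta> $ k $ l *\<^sub>R partial_deriv f k (\<alpha> \<beta>))"
proof -
  obtain f' where f': "(f has_derivative f') (at (\<alpha> \<beta>))"
    using f by (auto simp: differentiable_def)
  obtain \<alpha>' where \<alpha>': "(\<alpha> has_derivative \<alpha>') (at \<beta>)"
    using \<alpha> by (auto simp: differentiable_def)
  have "((\<lambda>b. f (\<alpha> b)) has_derivative (\<lambda>h. f' (\<alpha>' h))) (at \<beta>)"
    by (rule has_derivative_compose[OF \<alpha>' f'])
  \<comment> \<open>Agreement of \<open>g\<close> with the composite is known only on
    \<open>B\<close>; openness makes that enough for the derivative at \<beta>.\<close>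
  then have "(g has_derivative (\<lambda>h. f' (\<alpha>' h))) (at \<beta>)"
    by (rule has_derivative_transform_within_open[OF _ B(1,2)]) (simp add: B(3))
  then have g: "partial_deriv g l \<beta> = f' (\<alpha>' (axis l 1))"
    by (rule partial_deriv_eq)
  have S: "param_jacobian \<alpha> \<beta> $ k $ l = \<alpha>' (axis l 1) $ k" for k
    unfolding param_jacobian_def
    using partial_deriv_eq[OF bounded_linear.has_derivative[OF bounded_linear_vec_nth \<alpha>'], of k l]
    by simp
  have "\<alpha>' (axis l 1) = (\<Sum>k\<in>UNIV. \<alpha>' (axis l 1) $ k *\<^sub>R axis k 1)"
    using basis_expansion[of "\<alpha>' (axis l 1)"] by (simp add: scalar_mult_eq_scaleR)
  then have "f' (\<alpha>' (axis l 1)) = f' (\<Sum>k\<in>UNIV. \<alpha>' (axis l 1) $ k *\<^sub>R axis k 1)"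
    by simp
  also have "\<dots> = (\<Sum>k\<in>UNIV. \<alpha>' (axis l 1) $ k *\<^sub>R f' (axis k 1))"
    using has_derivative_linear[OF f'] by (simp add: linear_sum linear_scale)
  finally show ?thesis
    by (simp add: g S partial_deriv_eq[OF f'])
qed

theorem mainTheorem3:
  fixes A :: "(real^'k) set" and B :: "(real^'l) set"
    and U :: "real^'k \<Rightarrow> complex^'d^'d" and V :: "real^'l \<Rightarrow> complex^'d^'d"
    and \<alpha> :: "real^'l \<Rightarrow> real^'k" and \<rho>0 :: "complex^'d^'d" and \<beta> :: "real^'l"
  assumes "open A" and "open B"
    and "\<And>a. a \<in> A \<Longrightarrow> unitary (U a)"
    and "U differentiable_on A"
    and "\<alpha> differentiable_on B" and "\<alpha> ` B \<subseteq> A"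
    and "\<And>b. b \<in> B \<Longrightarrow> V b = U (\<alpha> b)"
    and "density_matrix \<rho>0"
    and "\<beta> \<in> B"
  defines "F\<alpha> \<equiv> QFIM (unitary_family U \<rho>0) (\<alpha> \<beta>)"
    and "F\<beta> \<equiv> QFIM (unitary_family V \<rho>0) \<beta>"
    and "S \<equiv> param_jacobian \<alpha> \<beta>"
  shows "(\<forall>l l'. F\<beta> $ l $ l' = (\<Sum>k\<in>UNIV. \<Sum>k'\<in>UNIV. S $ k $ l * F\<alpha> $ k $ k' * S $ k' $ l'))
       \<and> F\<beta> = transpose S ** F\<alpha> ** S"
proof -
  define r where "r = unitary_family U \<rho>0"
  define s where "s = unitary_family V \<rho>0"
  have psd: "pos_semidef \<rho>0" using assms(8) by (simp add: density_matrix_def)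
  have in_A: "\<alpha> \<beta> \<in> A" using assms(6,9) by auto
  obtain U' where U': "(U has_derivative U') (at (\<alpha> \<beta>))"
    using assms(1,4) in_A by (metis at_within_open differentiable_def differentiable_on_def)
  have d\<alpha>: "\<alpha> differentiable (at \<beta>)"
    using assms(2,5,9) by (metis at_within_open differentiable_on_def)
  have sr: "s b = r (\<alpha> b)" if "b \<in> B" for b
    using that assms(7) by (simp add: r_def s_def unitary_family_def)
  have "r differentiable (at (\<alpha> \<beta>))"
    unfolding r_def using unitary_family_has_derivative[OF U'] by (auto simp: differentiable_def)
  then have chain: "partial_deriv s l \<beta> = (\<Sum>k\<in>UNIV. S $ k $ l *\<^sub>R partial_deriv r k (\<alpha> \<beta>))" for l
    unfolding S_def by (rule partial_deriv_chain[of r \<alpha> \<beta> B s, OF _ d\<alpha> assms(2,9) sr])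
  have hr: "hermitian (r (\<alpha> \<beta>))"
    using pos_semidef_conjugate[OF psd] by (simp add: r_def unitary_family_def pos_semidef_def)
  then have hs: "hermitian (s \<beta>)" by (simp add: sr[OF assms(9)])
  obtain L where L: "\<And>k. is_SLD r (\<alpha> \<beta>) k (L k)"
    unfolding r_def using unitary_family_SLD_exists[OF U' assms(1) in_A assms(3) psd] by metis
  \<comment> \<open>The candidates follow the chain rule: the coefficients are real, so Hermiticity
    survives, and the defining equation is linear.\<close>
  define M where "M l = (\<Sum>k\<in>UNIV. S $ k $ l *\<^sub>R L k)" for l
  have M: "is_SLD s \<beta> l (M l)" for l
  proof -
    have "partial_deriv s l \<beta> = (\<Sum>k\<in>UNIV. S $ k $ l *\<^sub>R (1/2) *\<^sub>R anticommutator (L k) (r (\<alpha> \<beta>)))"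
      using L by (simp add: chain is_SLD_def)
    also have "\<dots> = (1/2) *\<^sub>R anticommutator (M l) (s \<beta>)"
      by (simp add: M_def sr[OF assms(9)] linear_sum[OF linear_anticommutator]
          linear_scale[OF linear_anticommutator] scaleR_sum_right mult.commute)
    finally show ?thesis
      using L by (simp add: is_SLD_def M_def hermitian_sum)
  qed
  have "F\<alpha> = (\<chi> k k'. partial_deriv r k (\<alpha> \<beta>) \<bullet> L k')"
    unfolding F\<alpha>_def r_def[symmetric] by (rule QFIM_eqI[of r, OF hr L]) simp
  then have Fa: "F\<alpha> $ k $ k' = partial_deriv r k (\<alpha> \<beta>) \<bullet> L k'" for k k' by simp
  have "F\<beta> = (\<chi> l l'. partial_deriv s l \<beta> \<bullet> M l')"
    unfolding F\<beta>_def s_def[symmetric] by (rule QFIM_eqI[of s, OF hs M]) simp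
  \<comment> \<open>Both arguments of the inner product expand linearly; the explicit
    \<open>sum.swap\<close> instance aligns the order of the two sums.\<close>
  then have Fb: "F\<beta> $ l $ l' = (\<Sum>k\<in>UNIV. \<Sum>k'\<in>UNIV. S $ k $ l * F\<alpha> $ k $ k' * S $ k' $ l')" for l l'
    by (simp add: chain M_def Fa inner_sum_left inner_sum_right sum_distrib_left mult_ac
        sum.swap[of "\<lambda>k k'. S $ k $ l' * (S $ k' $ l * (partial_deriv r k' (\<alpha> \<beta>) \<bullet> L k))"])
  have "F\<beta> = transpose S ** F\<alpha> ** S"
    by (simp add: vec_eq_iff Fb matrix_matrix_mult_def transpose_def sum_distrib_right, intro allI)
       (rule sum.swap)
  with Fb show ?thesis by blast
qed

end
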